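(* Let $p$ be a prime. The Laplacian spectrum of the cozero-divisor graph $\Gamma'(\mathbb{Z}_p[x]/(x^2))$ consists of the single eigenvalue $0$ with multiplicity $p-1$.
   Context: For a commutative ring $R$ with nonzero identity, the cozero-divisor graph $\Gamma'(R)$ is the simple undirected graph whose vertices are the nonzero non-unit elements of $R$, with two distinct vertices $u,v$ adjacent if and only if $u\notin Rv$ and $v\notin Ru$. $\mathbb{Z}_n$ denotes the ring of integers modulo $n$. The Laplacian matrix of a finite simple graph is $L=D-A$, where $D$ is the diagonal degree matrix and $A$ the adjacency matrix; the Laplacian spectrum is the multiset of eigenvalues of $L$ counted with multiplicity. *)

theory Defs
  imports
    "HOL-Algebra.Polynomial_Divisibility"
    "HOL-Number_Theory.Residues"
    "Graph_Theory.Pair_Digraph"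
    "Jordan_Normal_Form.Char_Poly"
begin

(* The undirected graph is encoded as in Graph_Theory, with each edge {u, v} represented by
   both arcs (u, v) and (v, u). The ideal Rv is PIdl v. *)
definition cozero_divisor_graph :: "('a, 'b) ring_scheme \<Rightarrow> 'a pair_pre_digraph" where
  "cozero_divisor_graph R =
     (let V = carrier R - {\<zero>\<^bsub>R\<^esub>} - Units R in
      \<lparr> pverts = V,
        parcs = {(u, v). u \<in> V \<and> v \<in> V \<and> u \<noteq> v \<and> u \<notin> PIdl\<^bsub>R\<^esub> v \<and> v \<notin> PIdl\<^bsub>R\<^esub> u} \<rparr>)"

lemma pair_graph_cozero_divisor_graph:
  assumes "finite (pverts (cozero_divisor_graph R))"
  shows "pair_graph (cozero_divisor_graph R)"
proof
  let ?G = "cozero_divisor_graph R"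
  have "parcs ?G \<subseteq> pverts ?G \<times> pverts ?G"
    by (auto simp: cozero_divisor_graph_def Let_def)
  then show "finite (parcs ?G)"
    using assms by (meson finite_SigmaI finite_subset)
qed (use assms in \<open>auto simp: cozero_divisor_graph_def Let_def arc_to_ends_def
      symmetric_def arcs_ends_def intro!: symI\<close>)

(* In the following three definitions the list vs is an enumeration of the vertices without
   repetition; it fixes the order of the rows and columns. *)
definition adjacency_mat :: "'a pair_pre_digraph \<Rightarrow> 'a list \<Rightarrow> complex mat" where
  "adjacency_mat G vs =
     mat (length vs) (length vs) (\<lambda>(i, j). if (vs ! i, vs ! j) \<in> parcs G then 1 else 0)"

(* In the two-arc encoding, the degree of a vertex is its out-degree. *)
definition degree_mat :: "'a pair_pre_digraph \<Rightarrow> 'a list \<Rightarrow> complex mat" where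
  "degree_mat G vs =
     mat (length vs) (length vs)
       (\<lambda>(i, j). if i = j then of_nat (out_degree (with_proj G) (vs ! i)) else 0)"

definition laplacian_mat :: "'a pair_pre_digraph \<Rightarrow> 'a list \<Rightarrow> complex mat" where
  "laplacian_mat G vs = degree_mat G vs - adjacency_mat G vs"

(* Over the complex numbers the characteristic polynomial splits, so its roots with their
   multiplicities are all the eigenvalues. *)
definition eigenvalue_mset :: "complex mat \<Rightarrow> complex multiset" where
  "eigenvalue_mset A = proots (char_poly A)"

definition Zp_x_mod_x2 :: "nat \<Rightarrow> int list set ring" where
  "Zp_x_mod_x2 p =
     (let P = poly_ring (residue_ring (int p)) in
      P Quot (PIdl\<^bsub>P\<^esub> (X\<^bsub>residue_ring (int p)\<^esub> [^]\<^bsub>P\<^esub> (2::nat))))"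

end

theory Submission
  imports Defs
begin

text \<open>
  Every element of \<open>\<int>\<^sub>p[x]/(x\<^sup>2)\<close> is \<open>a + bx\<close>. If \<open>a \<noteq> 0\<close>, it divides the unit
  \<open>(a + bx)(a - bx) = a\<^sup>2\<close>; otherwise it squares to \<open>0\<close>. So the vertices are the \<open>p - 1\<close> elements
  \<open>bx\<close> with \<open>b \<noteq> 0\<close>. Since these are associates of each other, the graph has no edges and its
  Laplacian matrix vanishes.
\<close>

text \<open>The graph computation depends only on these properties of \<open>\<epsilon>\<close>, so
  it is carried out here for an abstract commutative ring \<open>A\<close>, without cosets or
  polynomials. The quotient ring is shown to be an instance below.\<close>

locale field_dual_numbers = ring_hom_cring K A \<iota> + field K
  for K (structure) and A (structure) and \<iota> +
  fixes \<epsilon>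
  assumes eps_closed: "\<epsilon> \<in> carrier A"
    and eps_square: "\<epsilon> \<otimes>\<^bsub>A\<^esub> \<epsilon> = \<zero>\<^bsub>A\<^esub>"
    and eps_nonzero: "\<epsilon> \<noteq> \<zero>\<^bsub>A\<^esub>"
    and dual_number_decomp:
      "y \<in> carrier A \<Longrightarrow> \<exists>a\<in>carrier K. \<exists>b\<in>carrier K. y = \<iota> a \<oplus>\<^bsub>A\<^esub> \<iota> b \<otimes>\<^bsub>A\<^esub> \<epsilon>"
begin

lemma unit_image:
  assumes "a \<in> carrier K" "a \<noteq> \<zero>\<^bsub>K\<^esub>"
  shows "inv\<^bsub>K\<^esub> a \<in> carrier K" "\<iota> (inv\<^bsub>K\<^esub> a) \<otimes>\<^bsub>A\<^esub> \<iota> a = \<one>\<^bsub>A\<^esub>"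
proof -
  have a: "a \<in> Units K"
    using assms by (simp add: field_Units)
  then show i: "inv\<^bsub>K\<^esub> a \<in> carrier K"
    by simp
  show "\<iota> (inv\<^bsub>K\<^esub> a) \<otimes>\<^bsub>A\<^esub> \<iota> a = \<one>\<^bsub>A\<^esub>"
    using a i assms(1) by (simp flip: hom_mult)
qed

text \<open>The image of \<open>c\<close> is invertible, so the cofactor is the image of
  \<open>b\<close> times the inverse of the image of \<open>c\<close>. Used with \<open>b\<close>
  and \<open>c\<close> in both roles, this makes all nonzero multiples of \<open>\<epsilon>\<close>
  generate the same ideal, which rules out edges.\<close>

lemma scaled_eps_associated:
  assumes "b \<in> carrier K" "c \<in> carrier K" "c \<noteq> \<zero>\<^bsub>K\<^esub>"
  shows "\<iota> b \<otimes>\<^bsub>A\<^esub> \<epsilon> \<in> PIdl\<^bsub>A\<^esub> (\<iota> c \<otimes>\<^bsub>A\<^esub> \<epsilon>)"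
proof -
  note c = unit_image[OF assms(2,3)]
  have "(\<iota> b \<otimes>\<^bsub>A\<^esub> \<iota> (inv\<^bsub>K\<^esub> c)) \<otimes>\<^bsub>A\<^esub> (\<iota> c \<otimes>\<^bsub>A\<^esub> \<epsilon>)
      = \<iota> b \<otimes>\<^bsub>A\<^esub> ((\<iota> (inv\<^bsub>K\<^esub> c) \<otimes>\<^bsub>A\<^esub> \<iota> c) \<otimes>\<^bsub>A\<^esub> \<epsilon>)"
    using assms c(1) eps_closed by (simp add: S.m_assoc)
  also have "\<dots> = \<iota> b \<otimes>\<^bsub>A\<^esub> \<epsilon>"
    using assms c(2) eps_closed by simp
  finally have "\<iota> b \<otimes>\<^bsub>A\<^esub> \<epsilon>
      = (\<iota> b \<otimes>\<^bsub>A\<^esub> \<iota> (inv\<^bsub>K\<^esub> c)) \<otimes>\<^bsub>A\<^esub> (\<iota> c \<otimes>\<^bsub>A\<^esub> \<epsilon>)" ..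
  moreover have "\<iota> b \<otimes>\<^bsub>A\<^esub> \<iota> (inv\<^bsub>K\<^esub> c) \<in> carrier A"
    using assms(1) c(1) by simp
  ultimately show ?thesis
    unfolding cgenideal_def by blast
qed

lemma scaled_eps_eq_zero_iff:
  assumes "b \<in> carrier K"
  shows "\<iota> b \<otimes>\<^bsub>A\<^esub> \<epsilon> = \<zero>\<^bsub>A\<^esub> \<longleftrightarrow> b = \<zero>\<^bsub>K\<^esub>"
proof
  assume eq: "\<iota> b \<otimes>\<^bsub>A\<^esub> \<epsilon> = \<zero>\<^bsub>A\<^esub>"
  show "b = \<zero>\<^bsub>K\<^esub>"
  proof (rule ccontr)
    assume "b \<noteq> \<zero>\<^bsub>K\<^esub>"
    \<comment> \<open>If the multiple by \<open>b\<close> were zero, \<open>\<epsilon>\<close>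
      itself, as the multiple by one, would lie in the zero ideal.\<close>
    then have "\<iota> \<one>\<^bsub>K\<^esub> \<otimes>\<^bsub>A\<^esub> \<epsilon> \<in> PIdl\<^bsub>A\<^esub> (\<iota> b \<otimes>\<^bsub>A\<^esub> \<epsilon>)"
      using assms by (intro scaled_eps_associated) auto
    then show False
      using eps_closed eps_nonzero by (auto simp: eq cgenideal_def)
  qed
qed (use eps_closed in simp)

text \<open>The map is additive and its kernel is trivial by \<open>scaled_eps_eq_zero_iff\<close>.
  Injectivity is what makes the vertex count exact.\<close>

lemma inj_on_scaled_eps: "inj_on (\<lambda>b. \<iota> b \<otimes>\<^bsub>A\<^esub> \<epsilon>) (carrier K)"
proof (rule inj_onI)
  fix b c assume bc: "b \<in> carrier K" "c \<in> carrier K" and eq: "\<iota> b \<otimes>\<^bsub>A\<^esub> \<epsilon> = \<iota> c \<otimes>\<^bsub>A\<^esub> \<epsilon>"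
  have "\<iota> (b \<ominus>\<^bsub>K\<^esub> c) \<otimes>\<^bsub>A\<^esub> \<epsilon> = \<iota> b \<otimes>\<^bsub>A\<^esub> \<epsilon> \<ominus>\<^bsub>A\<^esub> \<iota> c \<otimes>\<^bsub>A\<^esub> \<epsilon>"
    using bc eps_closed by (simp add: R.minus_eq S.minus_eq S.l_distr S.l_minus)
  also have "\<dots> = \<zero>\<^bsub>A\<^esub>"
    using bc eps_closed by (simp add: eq S.minus_eq S.r_neg)
  finally have "b \<ominus>\<^bsub>K\<^esub> c = \<zero>\<^bsub>K\<^esub>"
    using scaled_eps_eq_zero_iff[OF R.minus_closed[OF bc]] by blast
  then show "b = c"
    using R.r_right_minus_eq[OF bc] by blast
qed

lemma dual_number_in_Units:
  assumes "a \<in> carrier K" "a \<noteq> \<zero>\<^bsub>K\<^esub>" "b \<in> carrier K"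
  shows "\<iota> a \<oplus>\<^bsub>A\<^esub> \<iota> b \<otimes>\<^bsub>A\<^esub> \<epsilon> \<in> Units A"
proof -
  define u v where "u = \<iota> a" and "v = \<iota> b \<otimes>\<^bsub>A\<^esub> \<epsilon>"
  have uv: "u \<in> carrier A" "v \<in> carrier A"
    using assms eps_closed by (auto simp: u_def v_def)
  have "v \<otimes>\<^bsub>A\<^esub> v = (\<iota> b \<otimes>\<^bsub>A\<^esub> \<iota> b) \<otimes>\<^bsub>A\<^esub> (\<epsilon> \<otimes>\<^bsub>A\<^esub> \<epsilon>)"
    unfolding v_def using assms eps_closed by (simp add: S.m_ac)
  then have v2: "v \<otimes>\<^bsub>A\<^esub> v = \<zero>\<^bsub>A\<^esub>"
    using assms by (simp add: eps_square)
  have "u \<in> Units A"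
    using unit_image[OF assms(1,2)] uv(1) S.m_comm unfolding u_def Units_def by force
  \<comment> \<open>Since \<open>v\<close> squares to zero, this product with the conjugate is the
    square of the unit \<open>u\<close>; a factor of a unit in a commutative ring is a unit.\<close>
  moreover have "(u \<oplus>\<^bsub>A\<^esub> v) \<otimes>\<^bsub>A\<^esub> (u \<ominus>\<^bsub>A\<^esub> v) = u \<otimes>\<^bsub>A\<^esub> u \<ominus>\<^bsub>A\<^esub> v \<otimes>\<^bsub>A\<^esub> v"
    using uv by algebra
  ultimately have "(u \<oplus>\<^bsub>A\<^esub> v) \<otimes>\<^bsub>A\<^esub> (u \<ominus>\<^bsub>A\<^esub> v) \<in> Units A"
    using uv by (simp add: v2 S.minus_eq)
  then have "u \<oplus>\<^bsub>A\<^esub> v \<in> Units A"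
    using uv S.unit_factor by blast
  then show ?thesis
    by (simp add: u_def v_def)
qed

text \<open>A unit of this form would make its factor \<open>\<epsilon>\<close> a unit, and
  cancelling \<open>\<epsilon>\<close> in the equation saying that its square is zero would give
  zero for \<open>\<epsilon>\<close>.\<close>

lemma scaled_eps_not_in_Units:
  assumes "b \<in> carrier K"
  shows "\<iota> b \<otimes>\<^bsub>A\<^esub> \<epsilon> \<notin> Units A"
proof
  assume "\<iota> b \<otimes>\<^bsub>A\<^esub> \<epsilon> \<in> Units A"
  then have "\<epsilon> \<in> Units A"
    using assms eps_closed S.unit_factor[of \<epsilon> "\<iota> b"] by (simp add: S.m_comm)
  then have "\<epsilon> = \<zero>\<^bsub>A\<^esub>"
    using eps_square eps_closed S.Units_l_cancel[of \<epsilon> \<epsilon> "\<zero>\<^bsub>A\<^esub>"] by simp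
  with eps_nonzero show False by simp
qed

lemma pverts_cozero_divisor_graph:
  "pverts (cozero_divisor_graph A) = (\<lambda>b. \<iota> b \<otimes>\<^bsub>A\<^esub> \<epsilon>) ` (carrier K - {\<zero>\<^bsub>K\<^esub>})"
  (is "?V = ?E")
proof (intro subset_antisym subsetI)
  fix y assume "y \<in> ?V"
  then have y: "y \<in> carrier A" "y \<noteq> \<zero>\<^bsub>A\<^esub>" "y \<notin> Units A"
    by (auto simp: cozero_divisor_graph_def Let_def)
  obtain a b where ab: "a \<in> carrier K" "b \<in> carrier K" "y = \<iota> a \<oplus>\<^bsub>A\<^esub> \<iota> b \<otimes>\<^bsub>A\<^esub> \<epsilon>"
    using dual_number_decomp[OF y(1)] by blast
  have "a = \<zero>\<^bsub>K\<^esub>"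
    using ab y(3) dual_number_in_Units by blast
  then have "y = \<iota> b \<otimes>\<^bsub>A\<^esub> \<epsilon>"
    using ab eps_closed by simp
  then show "y \<in> ?E"
    using ab(2) y(2) scaled_eps_eq_zero_iff by blast
next
  fix y assume "y \<in> ?E"
  then show "y \<in> ?V"
    using eps_closed scaled_eps_eq_zero_iff scaled_eps_not_in_Units
    by (auto simp: cozero_divisor_graph_def Let_def)
qed

lemma parcs_cozero_divisor_graph: "parcs (cozero_divisor_graph A) = {}"
proof -
  \<comment> \<open>Adjacency demands non-membership in both directions, so one membership for every
    ordered pair of vertices already excludes all arcs.\<close>
  have "u \<in> PIdl\<^bsub>A\<^esub> v"
    if "u \<in> pverts (cozero_divisor_graph A)" "v \<in> pverts (cozero_divisor_graph A)" for u v
    using that scaled_eps_associated unfolding pverts_cozero_divisor_graph by blast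
  then show ?thesis
    unfolding cozero_divisor_graph_def Let_def pair_pre_digraph.simps by blast
qed

lemma card_pverts_cozero_divisor_graph:
  "card (pverts (cozero_divisor_graph A)) = card (carrier K) - 1"
  unfolding pverts_cozero_divisor_graph card_image[OF inj_on_subset[OF inj_on_scaled_eps Diff_subset]]
  by (rule card_Diff_singleton[OF R.zero_closed])

end

lemma (in field) poly_decomp_var:
  assumes f: "f \<in> carrier (poly_ring R)"
  shows "\<exists>g\<in>carrier (poly_ring R). \<exists>a\<in>carrier R.
    f = poly_of_const a \<oplus>\<^bsub>poly_ring R\<^esub> g \<otimes>\<^bsub>poly_ring R\<^esub> X"
proof -
  interpret P: domain "poly_ring R"
    by (rule univ_poly_is_domain[OF carrier_is_subring])
  have X: "X \<in> carrier (poly_ring R)" "X \<noteq> []" "length X = 2"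
    using var_closed(1)[OF carrier_is_subring] by (auto simp: var_def)
  note closed = long_division_closed[OF carrier_is_subfield f X(1)]
  \<comment> \<open>The remainder is either the empty list or of degree below 1; truncated
    subtraction gives 0 in both cases, so the remainder is a constant.\<close>
  have "length (f pmod X) - 1 = 0"
    using pmod_degree[OF carrier_is_subfield f X(1,2)] X(3) by auto
  then have "f pmod X \<in> poly_of_const ` carrier R"
    using closed(2) by (simp add: poly_of_const_over_carrier)
  moreover have "f = f pmod X \<oplus>\<^bsub>poly_ring R\<^esub> (f pdiv X) \<otimes>\<^bsub>poly_ring R\<^esub> X"
    using pdiv_pmod[OF carrier_is_subfield f X(1)] closed X(1)
    by (simp add: P.a_comm P.m_comm)
  ultimately show ?thesis
    using closed(1) by (metis imageE)
qed

text \<open>Cancelling \<open>X\<close> in the domain of polynomials would make \<open>X\<close> a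
  divisor of one. The lemma guarantees that the class of \<open>X\<close> is nonzero in the
  quotient.\<close>

lemma (in field) var_not_in_cgenideal_var_square:
  "X \<notin> PIdl\<^bsub>poly_ring R\<^esub> (X \<otimes>\<^bsub>poly_ring R\<^esub> X)"
proof
  interpret P: domain "poly_ring R"
    by (rule univ_poly_is_domain[OF carrier_is_subring])
  have X: "X \<in> carrier (poly_ring R)" "X \<noteq> \<zero>\<^bsub>poly_ring R\<^esub>"
    using var_closed(1)[OF carrier_is_subring] by (auto simp: var_def univ_poly_zero)
  assume "X \<in> PIdl\<^bsub>poly_ring R\<^esub> (X \<otimes>\<^bsub>poly_ring R\<^esub> X)"
  then obtain f where f: "f \<in> carrier (poly_ring R)"
      "X = f \<otimes>\<^bsub>poly_ring R\<^esub> (X \<otimes>\<^bsub>poly_ring R\<^esub> X)"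
    by (auto simp: cgenideal_def)
  have "\<one>\<^bsub>poly_ring R\<^esub> \<otimes>\<^bsub>poly_ring R\<^esub> X = (f \<otimes>\<^bsub>poly_ring R\<^esub> X) \<otimes>\<^bsub>poly_ring R\<^esub> X"
    using f X by (simp add: P.m_assoc)
  then have "\<one>\<^bsub>poly_ring R\<^esub> = f \<otimes>\<^bsub>poly_ring R\<^esub> X"
    using f(1) X P.m_rcancel by blast
  \<comment> \<open>Coefficient lists start with the leading term, so multiplying a nonzero
    \<open>f\<close> by \<open>X\<close> appends a zero, whereas the polynomial one is the list
    containing only one.\<close>
  then show False
    using poly_mult_var[OF carrier_is_subring f(1)]
    by (auto simp: univ_poly_one split: if_splits)
qed

lemma (in ideal) rcos_eq_zero_iff:
  assumes "x \<in> carrier R"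
  shows "I +> x = \<zero>\<^bsub>R Quot I\<^esub> \<longleftrightarrow> x \<in> I"
  using assms rcos_const_imp_mem a_rcos_zero[OF ideal_axioms] unfolding FactRing_def by auto

lemma carrier_FactRingE:
  assumes "y \<in> carrier (R Quot I)"
  obtains x where "x \<in> carrier R" "y = I +>\<^bsub>R\<^esub> x"
  using assms unfolding FactRing_def A_RCOSETS_def' by auto

text \<open>The two membership conditions on \<open>I\<close> say exactly that the class of
  \<open>X\<close> squares to zero and is itself nonzero.\<close>

lemma (in field) field_dual_numbers_quotient:
  assumes I: "ideal I (poly_ring R)" "X \<otimes>\<^bsub>poly_ring R\<^esub> X \<in> I" "X \<notin> I"
  shows "field_dual_numbers R (poly_ring R Quot I)
    (\<lambda>a. I +>\<^bsub>poly_ring R\<^esub> poly_of_const a) (I +>\<^bsub>poly_ring R\<^esub> X)"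
proof -
  interpret P: domain "poly_ring R"
    by (rule univ_poly_is_domain[OF carrier_is_subring])
  have X: "X \<in> carrier (poly_ring R)"
    by (rule var_closed(1)[OF carrier_is_subring])
  interpret I: ideal I "poly_ring R"
    by (rule I(1))
  interpret Q: cring "poly_ring R Quot I"
    by (rule I.quotient_is_cring[OF P.is_cring])
  interpret h: ring_hom_ring "poly_ring R" "poly_ring R Quot I" "(+>\<^bsub>poly_ring R\<^esub>) I"
    by (rule I.rcos_ring_hom_ring)
  have const_hom: "poly_of_const \<in> Ring.ring_hom R (poly_ring R)"
    using canonical_embedding_is_hom[OF carrier_is_subring] by simp
  have eps_square: "(I +>\<^bsub>poly_ring R\<^esub> X) \<otimes>\<^bsub>poly_ring R Quot I\<^esub> (I +>\<^bsub>poly_ring R\<^esub> X)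
      = \<zero>\<^bsub>poly_ring R Quot I\<^esub>"
    using iffD2[OF I.rcos_eq_zero_iff[OF P.m_closed[OF X X]] I(2)]
    by (rule trans[OF h.hom_mult[OF X X, symmetric]])
  show ?thesis
  proof (intro field_dual_numbers.intro ring_hom_cring.intro ring_hom_cring_axioms.intro
      field_dual_numbers_axioms.intro)
    show "(\<lambda>a. I +>\<^bsub>poly_ring R\<^esub> poly_of_const a) \<in> Ring.ring_hom R (poly_ring R Quot I)"
      using ring_hom_trans[OF const_hom h.homh] by (simp add: comp_def)
    show "I +>\<^bsub>poly_ring R\<^esub> X \<noteq> \<zero>\<^bsub>poly_ring R Quot I\<^esub>"
      using I(3) by (rule contrapos_nn) (rule iffD1[OF I.rcos_eq_zero_iff[OF X]])
    fix y assume "y \<in> carrier (poly_ring R Quot I)"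
    then obtain f where f: "f \<in> carrier (poly_ring R)" "y = I +>\<^bsub>poly_ring R\<^esub> f"
      by (rule carrier_FactRingE)
    \<comment> \<open>Dividing by \<open>X\<close> twice writes \<open>f\<close> as a + (b + kX)X;
      the term with \<open>k\<close> carries the square of \<open>X\<close> and vanishes in the
      quotient.\<close>
    obtain g a where g: "g \<in> carrier (poly_ring R)" and a: "a \<in> carrier R"
      and f_eq: "f = poly_of_const a \<oplus>\<^bsub>poly_ring R\<^esub> g \<otimes>\<^bsub>poly_ring R\<^esub> X"
      using poly_decomp_var[OF f(1)] by blast
    obtain k b where k: "k \<in> carrier (poly_ring R)" and b: "b \<in> carrier R"
      and g_eq: "g = poly_of_const b \<oplus>\<^bsub>poly_ring R\<^esub> k \<otimes>\<^bsub>poly_ring R\<^esub> X"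
      using poly_decomp_var[OF g] by blast
    note const_closed = ring_hom_closed[OF const_hom a] ring_hom_closed[OF const_hom b]
    have "y = (I +>\<^bsub>poly_ring R\<^esub> poly_of_const a) \<oplus>\<^bsub>poly_ring R Quot I\<^esub>
        (I +>\<^bsub>poly_ring R\<^esub> poly_of_const b) \<otimes>\<^bsub>poly_ring R Quot I\<^esub> (I +>\<^bsub>poly_ring R\<^esub> X)"
      using const_closed k X unfolding f(2) f_eq g_eq
      by (simp add: Q.l_distr Q.m_assoc eps_square)
    with a b show "\<exists>a\<in>carrier R. \<exists>b\<in>carrier R. y =
        (I +>\<^bsub>poly_ring R\<^esub> poly_of_const a) \<oplus>\<^bsub>poly_ring R Quot I\<^esub>
        (I +>\<^bsub>poly_ring R\<^esub> poly_of_const b) \<otimes>\<^bsub>poly_ring R Quot I\<^esub> (I +>\<^bsub>poly_ring R\<^esub> X)"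
      by blast
  qed (use X eps_square in \<open>auto intro: is_cring Q.is_cring field_axioms\<close>)
qed

text \<open>The zero matrix is upper triangular, so its characteristic polynomial is the product of
  the linear factors of its diagonal entries, here the \<open>n\<close>-th power of the
  variable.\<close>

lemma eigenvalue_mset_zero_mat: "eigenvalue_mset (0\<^sub>m n n) = replicate_mset n 0"
proof -
  have "char_poly (0\<^sub>m n n :: complex mat) = (\<Prod>a\<leftarrow>diag_mat (0\<^sub>m n n). [:- a, 1:])"
    by (rule char_poly_upper_triangular[of _ n]) auto
  also have "diag_mat (0\<^sub>m n n :: complex mat) = replicate n 0"
    by (auto simp: diag_mat_def intro: nth_equalityI)
  finally have "char_poly (0\<^sub>m n n :: complex mat) = [:0, 1:] ^ n"
    by (simp add: prod_list_replicate)
  then show ?thesis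
    by (simp add: eigenvalue_mset_def proots_power)
qed

lemma laplacian_mat_no_arcs:
  assumes "parcs G = {}"
  shows "laplacian_mat G vs = 0\<^sub>m (length vs) (length vs)"
  using assms
  by (intro eq_matI)
    (auto simp: laplacian_mat_def degree_mat_def adjacency_mat_def out_degree_def out_arcs_def)

theorem theorem3p2:
  fixes p :: nat
  assumes "prime p"
  defines "G \<equiv> cozero_divisor_graph (Zp_x_mod_x2 p)"
  shows "finite (pverts G) \<and>
    (\<forall>vs. distinct vs \<and> set vs = pverts G \<longrightarrow>
       eigenvalue_mset (laplacian_mat G vs) = replicate_mset (p - 1) 0)"
proof -
  define K where "K = residue_ring (int p)"
  interpret K: residues_prime p K
    by unfold_locales (simp_all add: assms K_def)
  interpret P: domain "poly_ring K"
    by (rule K.univ_poly_is_domain[OF K.carrier_is_subring])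
  \<comment> \<open>The generator is written as a product, the form used by the lemmas above.
    Unfolding the second power leaves an extra factor one, which is removed because \<open>X\<close>
    lies in the carrier.\<close>
  define I where "I = PIdl\<^bsub>poly_ring K\<^esub> (X\<^bsub>K\<^esub> \<otimes>\<^bsub>poly_ring K\<^esub> X\<^bsub>K\<^esub>)"
  have X: "X\<^bsub>K\<^esub> \<in> carrier (poly_ring K)"
    by (rule K.var_closed(1)[OF K.carrier_is_subring])
  then have Zp_eq: "Zp_x_mod_x2 p = poly_ring K Quot I"
    by (simp add: Zp_x_mod_x2_def I_def K_def[symmetric] numeral_2_eq_2 Let_def)
  interpret D: field_dual_numbers K "Zp_x_mod_x2 p"
    "\<lambda>a. I +>\<^bsub>poly_ring K\<^esub> K.poly_of_const a" "I +>\<^bsub>poly_ring K\<^esub> X\<^bsub>K\<^esub>"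
    unfolding Zp_eq I_def
    by (rule K.field_dual_numbers_quotient[OF P.cgenideal_ideal P.cgenideal_self
          K.var_not_in_cgenideal_var_square]) (rule P.m_closed[OF X X])+
  have card: "card (pverts G) = p - 1"
    using D.card_pverts_cozero_divisor_graph by (simp add: G_def K.res_carrier_eq)
  have "finite (pverts G)"
    by (simp add: G_def D.pverts_cozero_divisor_graph)
  moreover have "eigenvalue_mset (laplacian_mat G vs) = replicate_mset (p - 1) 0"
    if vs: "distinct vs" "set vs = pverts G" for vs
  proof -
    \<comment> \<open>Every enumeration has this length, so the Laplacian is the zero matrix of one
      fixed size, whatever the order of the vertices.\<close>
    have "length vs = p - 1"
      using distinct_card[OF vs(1)] vs(2) card by simp
    then show ?thesis
      using laplacian_mat_no_arcs[of G vs] D.parcs_cozero_divisor_graph eigenvalue_mset_zero_mat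
      by (simp add: G_def)
  qed
  ultimately show ?thesis
    by blast
qed

end
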